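(* Let $X$ be a uniformly convex real Banach space with $\dim X\ge 2$. Then $\mathrm{DR}_B(X)<2$. In addition, for each $\varepsilon>0$ there exists $\theta=\theta_X(\varepsilon)>0$ such that whenever $u,v\in S_X$, $u\perp_B v$ and $\|u-v\|\ge\varepsilon$, one has $$\Phi_X(u,v)\le 2-\theta.$$
   Context: $S_X$ is the unit sphere of $X$. Birkhoff orthogonality: $x\perp_B y$ iff $\|x+\lambda y\|\ge\|x\|$ for all $\lambda\in\mathbb R$. For $u,v\in S_X$ with $u\perp_B v$, $\Phi_X(u,v)=\sup_{t>0}\frac{\|u-v\|}{\|tu-t^{-1}v\|}$. For nonzero $x,y\in X$ put $\alpha[x,y]=\left\|\frac{x}{\|x\|}-\frac{y}{\|y\|}\right\|$ and $\beta[x,y]=\left\|\frac{x}{\|y\|}-\frac{y}{\|x\|}\right\|$, and $$\mathrm{DR}_B(X)=\sup\left\{\frac{\alpha[x,y]}{\beta[x,y]}: x,y\in X\setminus\{0\},\ x\perp_B y,\ \beta[x,y]\ne 0\right\}.$$ $X$ is uniformly convex if $\delta_X(\varepsilon)>0$ for every $0<\varepsilon\le2$, where $\delta_X(\varepsilon)=\inf\{1-\|\frac{x+y}{2}\|: x,y\in S_X,\ \|x-y\|\ge\varepsilon\}$. *)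

theory Defs
  imports "HOL-Analysis.Analysis"
begin

definition birkhoff_orth :: "'a::real_normed_vector \<Rightarrow> 'a \<Rightarrow> bool"  (infix "\<bottom>\<^sub>B" 50)
  where "x \<bottom>\<^sub>B y \<longleftrightarrow> (\<forall>l::real. norm (x + l *\<^sub>R y) \<ge> norm x)"

text \<open>
  The suprema below are taken in the extended reals, so that an upper bound on
  them includes the claim that the corresponding set of reals is bounded above.
  For \<open>u \<bottom>\<^sub>B v\<close> with \<open>norm u = 1\<close> the denominator in \<open>Phi\<close> is at least \<open>t\<close>, hence nonzero.
\<close>

definition Phi :: "'a::real_normed_vector \<Rightarrow> 'a \<Rightarrow> ereal"
  where "Phi u v = (SUP t\<in>{0<..}. ereal (norm (u - v) / norm (t *\<^sub>R u - inverse t *\<^sub>R v)))"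

definition alpha_dist :: "'a::real_normed_vector \<Rightarrow> 'a \<Rightarrow> real"
  where "alpha_dist x y = norm (x /\<^sub>R norm x - y /\<^sub>R norm y)"

definition beta_dist :: "'a::real_normed_vector \<Rightarrow> 'a \<Rightarrow> real"
  where "beta_dist x y = norm (x /\<^sub>R norm y - y /\<^sub>R norm x)"

definition DR_B :: "'a::real_normed_vector itself \<Rightarrow> ereal"
  where "DR_B _ = Sup {ereal (alpha_dist x y / beta_dist x y) | x y::'a.
           x \<noteq> 0 \<and> y \<noteq> 0 \<and> x \<bottom>\<^sub>B y \<and> beta_dist x y \<noteq> 0}"

text \<open>
  For \<open>e \<le> 2\<close> and a nonzero space, the set below is nonempty (take \<open>y = - x\<close>) and
  bounded below by \<open>0\<close>, so the real-valued \<open>Inf\<close> is the true infimum.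
\<close>

definition convexity_modulus :: "'a::real_normed_vector itself \<Rightarrow> real \<Rightarrow> real"
  where "convexity_modulus _ e = Inf {1 - norm ((x + y) /\<^sub>R 2) | x y::'a.
           x \<in> sphere 0 1 \<and> y \<in> sphere 0 1 \<and> norm (x - y) \<ge> e}"

definition uniformly_convex :: "'a::real_normed_vector itself \<Rightarrow> bool"
  where "uniformly_convex X \<longleftrightarrow> (\<forall>e. 0 < e \<and> e \<le> 2 \<longrightarrow> convexity_modulus X e > 0)"

end

theory Submission
  imports Defs
begin

text \<open>
  In every normed space, unit vectors \<open>u \<bottom>\<^sub>B v\<close> satisfy \<open>Phi u v \<le> sqrt 2\<close>, which gives
  both claims at once with \<open>\<theta> = 2 - sqrt 2\<close>. Put \<open>D = norm (t u - v / t)\<close>. Orthogonality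
  gives \<open>D \<ge> t\<close> and the triangle inequality gives \<open>D \<ge> 1 / t - t\<close>. Scaling one of the two
  terms of \<open>D\<close> to norm one yields \<open>norm (u - v) \<le> t D + (1 - t\<^sup>2)\<close> if \<open>t \<le> 1\<close> and
  \<open>norm (u - v) \<le> D / t + (1 - 1 / t\<^sup>2)\<close> if \<open>t \<ge> 1\<close>. The remainders are absorbed by the
  two lower bounds for \<open>D\<close>; the worst value of \<open>t\<close> is \<open>1 / sqrt 2\<close>.
\<close>

lemma norm_diff_le_sqrt2_mult:
  fixes u v :: "'a::real_normed_vector"
  assumes u: "norm u = 1" and v: "norm v = 1" and orth: "u \<bottom>\<^sub>B v" and t: "t > 0"
  shows "norm (u - v) \<le> sqrt 2 * norm (t *\<^sub>R u - inverse t *\<^sub>R v)"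
proof -
  define r where "r = inverse t"
  define A where "A = norm (u - v)"
  define D where "D = norm (t *\<^sub>R u - r *\<^sub>R v)"
  have r: "r > 0" "r * t = 1"
    using t by (auto simp: r_def)
  have A: "A \<ge> 0"
    by (simp add: A_def)
  have rD: "r * D = norm (u - (r * r) *\<^sub>R v)"
  proof -
    have "r * D = norm (r *\<^sub>R (t *\<^sub>R u - r *\<^sub>R v))"
      using r by (simp add: D_def)
    also have "r *\<^sub>R (t *\<^sub>R u - r *\<^sub>R v) = u - (r * r) *\<^sub>R v"
      using r by (simp add: scaleR_diff_right)
    finally show ?thesis .
  qed
  have tD: "t * D = norm ((t * t) *\<^sub>R u - v)"
  proof -
    have "t * D = norm (t *\<^sub>R (t *\<^sub>R u - r *\<^sub>R v))"
      using t by (simp add: D_def)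
    also have "t *\<^sub>R (t *\<^sub>R u - r *\<^sub>R v) = (t * t) *\<^sub>R u - v"
      using r by (simp add: scaleR_diff_right mult.commute)
    finally show ?thesis .
  qed
  \<comment> \<open>Orthogonality is tested at the scalar that turns its left side into
    \<open>r * D\<close>; multiplying by \<open>t\<close> then gives
    \<open>D \<ge> t\<close>.\<close>
  have "norm (u + (- (r * r)) *\<^sub>R v) \<ge> 1"
    using orth u unfolding birkhoff_orth_def by metis
  then have one_le: "1 \<le> r * D"
    by (simp add: rD)
  have "t * 1 \<le> t * (r * D)"
    using one_le t by (intro mult_left_mono) auto
  then have t_le: "t \<le> D"
    using r by (simp add: mult.assoc[symmetric] mult.commute[of t r])
  have "norm v \<le> norm ((t * t) *\<^sub>R u) + norm (v - (t * t) *\<^sub>R u)"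
    by (metis norm_triangle_sub)
  then have lower: "1 - t * t \<le> t * D"
    using u v by (simp add: tD norm_minus_commute)
  have "A \<le> sqrt 2 * D"
  proof (cases "t \<le> 1")
    case True
    then have tt: "t * t \<le> 1"
      using t by (simp add: mult_le_one)
    have "u - v = ((t * t) *\<^sub>R u - v) + (1 - t * t) *\<^sub>R u"
      by (simp add: scaleR_diff_left)
    then have "A \<le> t * D + norm ((1 - t * t) *\<^sub>R u)"
      unfolding A_def tD by (metis norm_triangle_ineq)
    then have upper: "A \<le> t * D + (1 - t * t)"
      using tt u by simp
    show ?thesis
    proof (cases "2 * (t * t) \<le> 1")
      case True
      \<comment> \<open>For small \<open>t\<close>, \<open>lower\<close> replaces the remainder in
        \<open>upper\<close> by a second \<open>t * D\<close>, so
        \<open>A \<le> 2 * t * D\<close>.\<close>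
      have "2 * t \<le> sqrt 2"
        using True by (intro real_le_rsqrt) (simp add: power2_eq_square)
      then have "2 * t * D \<le> sqrt 2 * D"
        using t t_le by (intro mult_right_mono) auto
      with upper lower show ?thesis
        by linarith
    next
      case False
      \<comment> \<open>Here \<open>t \<le> D\<close> is the better bound: \<open>t\<close> times
        the right side of \<open>upper\<close> is at most the convex combination
        \<open>t * t * D + (1 - t * t) * D = D\<close>.\<close>
      have "(1 - t * t) * t \<le> (1 - t * t) * D"
        using tt t_le by (intro mult_left_mono) auto
      moreover have "t * A \<le> t * (t * D + (1 - t * t))"
        using upper t by (intro mult_left_mono) auto
      ultimately have tA: "t * A \<le> D"
        by (simp add: algebra_simps)
      have "1 \<le> sqrt (2 * (t * t))"
        using False by simp
      then have "1 \<le> sqrt 2 * t"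
        using t by (simp add: real_sqrt_mult)
      then have "1 * A \<le> sqrt 2 * t * A"
        using A by (intro mult_right_mono) auto
      also have "\<dots> \<le> sqrt 2 * D"
        using tA by (simp add: mult.assoc)
      finally show ?thesis
        by simp
    qed
  next
    case False
    then have "r \<le> 1"
      by (simp add: r_def inverse_le_1_iff)
    then have rr: "r * r \<le> 1"
      using r by (simp add: mult_le_one)
    have "u - v = (u - (r * r) *\<^sub>R v) - (1 - r * r) *\<^sub>R v"
      by (simp add: scaleR_diff_left)
    then have "A \<le> r * D + norm ((1 - r * r) *\<^sub>R v)"
      unfolding A_def rD by (metis norm_triangle_ineq4)
    then have "A \<le> r * D + (1 - r * r) * 1"
      using rr v by simp
    \<comment> \<open>The factor 1 is replaced by \<open>r * D\<close>, which makes the whole bound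
      a multiple of \<open>D\<close>.\<close>
    also have "\<dots> \<le> r * D + (1 - r * r) * (r * D)"
      using one_le rr by (intro add_left_mono mult_left_mono) auto
    also have "\<dots> = r * (2 - r * r) * D"
      by (simp add: algebra_simps)
    also have "\<dots> \<le> sqrt 2 * D"
    proof (rule mult_right_mono)
      \<comment> \<open>With \<open>s = r * r\<close> this is
        \<open>s * (2 - s) = 1 - (1 - s)\<^sup>2\<close>; the two factors are at most 1 and
        2.\<close>
      have "(r * (2 - r * r))\<^sup>2 = (1 - (1 - r * r)\<^sup>2) * (2 - r * r)"
        by (simp add: power2_eq_square algebra_simps)
      also have "\<dots> \<le> 1 * 2"
        using rr r by (intro mult_mono) auto
      finally show "r * (2 - r * r) \<le> sqrt 2"
        by (intro real_le_rsqrt) simp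
    qed (simp add: D_def)
    finally show ?thesis .
  qed
  then show ?thesis
    by (simp add: A_def D_def r_def)
qed

lemma Phi_le_sqrt2:
  fixes u v :: "'a::real_normed_vector"
  assumes "norm u = 1" "norm v = 1" "u \<bottom>\<^sub>B v"
  shows "Phi u v \<le> ereal (sqrt 2)"
  unfolding Phi_def
proof (rule SUP_least)
  fix t :: real
  assume "t \<in> {0<..}"
  then have "norm (u - v) \<le> sqrt 2 * norm (t *\<^sub>R u - inverse t *\<^sub>R v)"
    using assms norm_diff_le_sqrt2_mult by auto
  then show "ereal (norm (u - v) / norm (t *\<^sub>R u - inverse t *\<^sub>R v)) \<le> ereal (sqrt 2)"
    \<comment> \<open>A zero denominator is harmless, since division by zero yields 0.\<close>
    by (cases "norm (t *\<^sub>R u - inverse t *\<^sub>R v) = 0") (auto simp: divide_le_eq)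
qed

text \<open>For \<open>a \<noteq> 0\<close> the scalar \<open>l\<close> is absorbed into
  \<open>l * b / a\<close>. This allows passing to unit vectors.\<close>

lemma birkhoff_orth_scaleR:
  assumes "x \<bottom>\<^sub>B y"
  shows "(a *\<^sub>R x) \<bottom>\<^sub>B (b *\<^sub>R y)"
  unfolding birkhoff_orth_def
proof
  fix l :: real
  show "norm (a *\<^sub>R x) \<le> norm (a *\<^sub>R x + l *\<^sub>R b *\<^sub>R y)"
  proof (cases "a = 0")
    case False
    have "norm x \<le> norm (x + (l * b / a) *\<^sub>R y)"
      using assms by (simp add: birkhoff_orth_def)
    then have "norm (a *\<^sub>R x) \<le> norm (a *\<^sub>R (x + (l * b / a) *\<^sub>R y))"
      by (simp add: mult_left_mono)
    with False show ?thesis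
      by (simp add: scaleR_add_right)
  qed simp
qed

text \<open>Each quotient here is one of those in \<open>Phi u v\<close>, for the normalised vectors
  \<open>u\<close>, \<open>v\<close> of \<open>x\<close>, \<open>y\<close> and the parameter
  \<open>t = norm x / norm y\<close>.\<close>

lemma DR_B_le_sqrt2: "DR_B TYPE('a::real_normed_vector) \<le> ereal (sqrt 2)"
  unfolding DR_B_def
proof (rule Sup_least, clarify)
  fix x y :: 'a
  assume nz: "x \<noteq> 0" "y \<noteq> 0" and orth: "x \<bottom>\<^sub>B y" and "beta_dist x y \<noteq> 0"
  then have pos: "beta_dist x y > 0"
    by (simp add: beta_dist_def)
  have "alpha_dist x y \<le> sqrt 2 * norm ((norm x / norm y) *\<^sub>R (x /\<^sub>R norm x)
      - inverse (norm x / norm y) *\<^sub>R (y /\<^sub>R norm y))"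
    unfolding alpha_dist_def using nz birkhoff_orth_scaleR[OF orth]
    by (intro norm_diff_le_sqrt2_mult) auto
  also have "\<dots> = sqrt 2 * beta_dist x y"
    using nz by (simp add: beta_dist_def field_simps)
  finally show "ereal (alpha_dist x y / beta_dist x y) \<le> ereal (sqrt 2)"
    using pos by (simp add: divide_le_eq)
qed

theorem theorem3p2:
  assumes "uniformly_convex TYPE('a::banach)"
    and "\<exists>B::'a set. independent B \<and> card B = 2"
  shows "DR_B TYPE('a) < 2 \<and>
    (\<forall>\<epsilon>::real. \<epsilon> > 0 \<longrightarrow> (\<exists>\<theta>::real. \<theta> > 0 \<and>
      (\<forall>u v::'a. u \<in> sphere 0 1 \<and> v \<in> sphere 0 1 \<and> u \<bottom>\<^sub>B v \<and> norm (u - v) \<ge> \<epsilon>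
        \<longrightarrow> Phi u v \<le> ereal (2 - \<theta>))))"
proof (intro conjI allI impI)
  have sqrt2: "sqrt 2 < 2"
    by (simp add: real_less_lsqrt)
  then have "ereal (sqrt 2) < 2"
    by simp
  then show "DR_B TYPE('a) < 2"
    using DR_B_le_sqrt2 by (rule le_less_trans[rotated])
  show "\<exists>\<theta>>0. \<forall>u v::'a. u \<in> sphere 0 1 \<and> v \<in> sphere 0 1 \<and> u \<bottom>\<^sub>B v \<and> norm (u - v) \<ge> \<epsilon>
      \<longrightarrow> Phi u v \<le> ereal (2 - \<theta>)" for \<epsilon> :: real
    using sqrt2 Phi_le_sqrt2 by (intro exI[of _ "2 - sqrt 2"]) auto
qed

end
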